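(* Consider the matrix $A$ defined using one of the methods IFD$(1,1)$, IFD$(2,2)$, HIFD$(2,2)$ for the two-dimensional Poisson equation with Dirichlet boundary condition on a uniform grid of size $h$. Let $M$ be the MILU preconditioner of $A$ defined by the lexicographic order. Then $$\kappa(M^{-1}A)=\mathcal O(h^{-1}).$$
   Context: Grid: a uniform grid of size $h$ on a fixed rectangle, with unknowns $u_{i,j}$, $1\le i\le n_x$, $1\le j\le n_y$, where $(n_x+1)h$ and $(n_y+1)h$ are the side lengths; values at points outside this index range are Dirichlet data moved to the right-hand side (i.e. set to $0$ in the definition of $A$). The $\mathcal O$ is as $h\to0$. Matrix: with $v=(v_{-2},v_{-1},v_0,v_1,v_2)=(d,\ b-4d,\ 1-2b+6d,\ b-4d,\ d)$, $D_xu_{i,j}=\sum_{r=-2}^2v_ru_{i+r,j}$, $D_yu_{i,j}=\sum_{r=-2}^2v_ru_{i,j+r}$, and $c_{-s}=c_s$, $$(Au)_{i,j}=-\frac1{h^2}\sum_{s=-m}^{m}c_sD_yu_{i+s,j}-\frac1{h^2}\sum_{s=-m}^{m}c_sD_xu_{i,j+s}.$$ Coefficients: IFD$(1,1)$: $m=1$, $c_0=-2$, $c_1=1$, $b=\tfrac1{12}$, $d=0$. IFD$(2,2)$: $m=2$, $c_0=-\tfrac{17}{10}$, $c_1=\tfrac45$, $c_2=\tfrac1{20}$, $b=\tfrac2{15}$, $d=0$. HIFD$(2,2)$: $m=2$, $c_0=-\tfrac{53}{42}$, $c_1=\tfrac{32}{63}$, $c_2=\tfrac{31}{252}$, $b=\tfrac{13}{63}$,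 $d=\tfrac1{164}$. In these cases $A$ is a symmetric positive definite M-matrix. Lexicographic order: $(i',j')\prec(i,j)$ iff $i'<i$, or $i'=i$ and $j'<j$. For a grid point $K$: $n_0(K)=\{K'\neq K:A_{K,K'}\ne0\}$, $p(K)=\{K'\in n_0(K):K'\prec K\}$, $s(K)=\{K'\in n_0(K):K\prec K'\}$. MILU preconditioner: write $A=L+D+L^\top$ with $D$ the diagonal of $A$ and $L_{K,K'}=A_{K,K'}$ if $K'\in p(K)$, $0$ otherwise. Define recursively along $\prec$ $$e_K=A_{K,K}-\sum_{K_1\in p(K)}\ \sum_{K_2\in s(K_1)}\frac{A_{K,K_1}A_{K_1,K_2}}{e_{K_1}},$$ $E=\mathrm{diag}(e_K)$, $M=(L+E)E^{-1}(L+E)^\top$. $\kappa(\cdot)=\lambda_{\max}/\lambda_{\min}$ is the ratio of the largest to the smallest eigenvalue. *)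

theory Defs
  imports
    "HOL-Library.Landau_Symbols"
    "Jordan_Normal_Form.Spectral_Radius"
    "Jordan_Normal_Form.Gauss_Jordan_Elimination"
begin

datatype fd_scheme = IFD11 | IFD22 | HIFD22

fun half_width :: "fd_scheme \<Rightarrow> int" where
  "half_width IFD11 = 1"
| "half_width IFD22 = 2"
| "half_width HIFD22 = 2"

fun c_coeff :: "fd_scheme \<Rightarrow> int \<Rightarrow> real" where
  "c_coeff IFD11 s = (if s = 0 then -2 else if \<bar>s\<bar> = 1 then 1 else 0)"
| "c_coeff IFD22 s =
    (if s = 0 then -17/10 else if \<bar>s\<bar> = 1 then 4/5 else if \<bar>s\<bar> = 2 then 1/20 else 0)"
| "c_coeff HIFD22 s =
    (if s = 0 then -53/42 else if \<bar>s\<bar> = 1 then 32/63 else if \<bar>s\<bar> = 2 then 31/252 else 0)"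

fun b_coeff :: "fd_scheme \<Rightarrow> real" where
  "b_coeff IFD11 = 1/12"
| "b_coeff IFD22 = 2/15"
| "b_coeff HIFD22 = 13/63"

fun d_coeff :: "fd_scheme \<Rightarrow> real" where
  "d_coeff IFD11 = 0"
| "d_coeff IFD22 = 0"
| "d_coeff HIFD22 = 1/164"

definition v_coeff :: "fd_scheme \<Rightarrow> int \<Rightarrow> real" where
  "v_coeff S r =
    (if r = 0 then 1 - 2 * b_coeff S + 6 * d_coeff S
     else if \<bar>r\<bar> = 1 then b_coeff S - 4 * d_coeff S
     else if \<bar>r\<bar> = 2 then d_coeff S
     else 0)"

type_synonym point = "int \<times> int"

definition grid :: "nat \<Rightarrow> nat \<Rightarrow> point set" where
  "grid nx ny = {1..int nx} \<times> {1..int ny}"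

definition Dx :: "fd_scheme \<Rightarrow> (point \<Rightarrow> real) \<Rightarrow> point \<Rightarrow> real" where
  "Dx S u = (\<lambda>(i, j). \<Sum>r = -2..2. v_coeff S r * u (i + r, j))"

definition Dy :: "fd_scheme \<Rightarrow> (point \<Rightarrow> real) \<Rightarrow> point \<Rightarrow> real" where
  "Dy S u = (\<lambda>(i, j). \<Sum>r = -2..2. v_coeff S r * u (i, j + r))"

(* To be applied to functions u that vanish outside the grid (Dirichlet condition). *)
definition fd_op :: "fd_scheme \<Rightarrow> real \<Rightarrow> (point \<Rightarrow> real) \<Rightarrow> point \<Rightarrow> real" where
  "fd_op S h u = (\<lambda>(i, j).
     - (1 / h\<^sup>2) * (\<Sum>s = - half_width S..half_width S. c_coeff S s * Dy S u (i + s, j))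
     - (1 / h\<^sup>2) * (\<Sum>s = - half_width S..half_width S. c_coeff S s * Dx S u (i, j + s)))"

(* Column K' of A is A applied to the unit vector at K'; if K' is a grid point, this unit
   vector vanishes outside the grid, as required by fd_op. *)
definition fd_entry :: "fd_scheme \<Rightarrow> real \<Rightarrow> point \<Rightarrow> point \<Rightarrow> real" where
  "fd_entry S h K K' = fd_op S h (\<lambda>P. if P = K' then 1 else 0) K"

definition lex_less :: "point \<Rightarrow> point \<Rightarrow> bool" where
  "lex_less K' K \<longleftrightarrow> fst K' < fst K \<or> fst K' = fst K \<and> snd K' < snd K"

definition nbrs :: "nat \<Rightarrow> nat \<Rightarrow> (point \<Rightarrow> point \<Rightarrow> real) \<Rightarrow> point \<Rightarrow> point set" where
  "nbrs nx ny a K = {K' \<in> grid nx ny. K' \<noteq> K \<and> a K K' \<noteq> 0}"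

definition preds :: "nat \<Rightarrow> nat \<Rightarrow> (point \<Rightarrow> point \<Rightarrow> real) \<Rightarrow> point \<Rightarrow> point set" where
  "preds nx ny a K = {K' \<in> nbrs nx ny a K. lex_less K' K}"

definition succs :: "nat \<Rightarrow> nat \<Rightarrow> (point \<Rightarrow> point \<Rightarrow> real) \<Rightarrow> point \<Rightarrow> point set" where
  "succs nx ny a K = {K' \<in> nbrs nx ny a K. lex_less K K'}"

function milu_diag ::
  "nat \<Rightarrow> nat \<Rightarrow> (point \<Rightarrow> point \<Rightarrow> real) \<Rightarrow> point \<Rightarrow> real" where
  "milu_diag nx ny a K =
     a K K - (\<Sum>K1 \<in> preds nx ny a K. \<Sum>K2 \<in> succs nx ny a K1.
                a K K1 * a K1 K2 / milu_diag nx ny a K1)"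
  by pat_completeness auto

termination
  by (relation "measures [\<lambda>(_, _, _, K). nat (fst K), \<lambda>(_, _, _, K). nat (snd K)]")
     (auto simp: preds_def nbrs_def grid_def lex_less_def)

declare milu_diag.simps [simp del]

(* Rows and columns are numbered in lexicographic order of the grid points, from 0. *)
definition nth_point :: "nat \<Rightarrow> nat \<Rightarrow> point" where
  "nth_point ny k = (int (k div ny) + 1, int (k mod ny) + 1)"

definition grid_mat :: "nat \<Rightarrow> nat \<Rightarrow> (point \<Rightarrow> point \<Rightarrow> real) \<Rightarrow> real mat" where
  "grid_mat nx ny a =
     mat (nx * ny) (nx * ny) (\<lambda>(k, l). a (nth_point ny k) (nth_point ny l))"

definition mat_inv :: "real mat \<Rightarrow> real mat" where
  "mat_inv X = the (mat_inverse X)"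

definition milu :: "nat \<Rightarrow> nat \<Rightarrow> (point \<Rightarrow> point \<Rightarrow> real) \<Rightarrow> real mat" where
  "milu nx ny a =
    (let L = grid_mat nx ny (\<lambda>K K'. if K' \<in> preds nx ny a K then a K K' else 0);
         E = grid_mat nx ny (\<lambda>K K'. if K = K' then milu_diag nx ny a K else 0)
     in (L + E) * mat_inv E * transpose_mat (L + E))"

definition fd_mat :: "fd_scheme \<Rightarrow> real \<Rightarrow> nat \<Rightarrow> nat \<Rightarrow> real mat" where
  "fd_mat S h nx ny = grid_mat nx ny (fd_entry S h)"

definition milu_mat :: "fd_scheme \<Rightarrow> real \<Rightarrow> nat \<Rightarrow> nat \<Rightarrow> real mat" where
  "milu_mat S h nx ny = milu nx ny (fd_entry S h)"

definition kappa :: "real mat \<Rightarrow> real" where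
  "kappa X = Max (spectrum X) / Min (spectrum X)"

(* The limit h \<rightarrow> 0 through the grids of size h that fit the rectangle with side lengths
   lx, ly. This filter is trivial if no such grids with arbitrarily small h exist, that is,
   if lx / ly is irrational. *)
definition mesh_refinement :: "real \<Rightarrow> real \<Rightarrow> (real \<times> nat \<times> nat) filter" where
  "mesh_refinement lx ly =
     inf (filtercomap fst (at_right 0))
         (principal {(h, nx, ny). 1 \<le> nx \<and> 1 \<le> ny
            \<and> (real nx + 1) * h = lx \<and> (real ny + 1) * h = ly})"

end

theory Submission
  imports Defs "HOL-Library.Product_Plus"
begin

text \<open>
  The condition number is bounded by comparing the quadratic forms of \<open>A\<close> and \<open>M\<close>:
  if \<open>x\<^sup>T M x \<le> x\<^sup>T A x\<close> and \<open>(1 - \<tau>) x\<^sup>T A x \<le> x\<^sup>T M x\<close>, then all eigenvalues of the quotient of \<open>A\<close> by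
  \<open>M\<close> lie between \<open>1\<close> and \<open>1 / (1 - \<tau>)\<close>.

  The recursion for the pivots \<open>e\<close> is such that \<open>M\<close> and \<open>A\<close> have equal row sums. So \<open>A - M\<close> is a sum of
  graph Laplacians, one for each point \<open>K\<close>, living on the successors of \<open>K\<close>; its form at \<open>x\<close> is a
  weighted variance of the values of \<open>x\<close> there (\<open>M_form_eq\<close>). A variance is nonnegative, which gives
  the first inequality. It is also at most the second moment about the value at \<open>K\<close>; weighted by
  the matrix entries, this moment is the energy of the edges from \<open>K\<close> to its successors, which
  are a part of \<open>x\<^sup>T A x\<close>. The factor in front is the ratio \<open>s / e\<close> of the sum \<open>s\<close> of the absolute
  values of the entries of \<open>A\<close> at the successors of \<open>K\<close> to the pivot at \<open>K\<close>. Hence the second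
  inequality holds for any bound \<open>\<tau> < 1\<close> on these ratios (\<open>A_form_le_M_form\<close>).

  It remains to bound the ratios. The three stencils are symmetric, have sum zero and nonpositive
  entries outside the centre, so that the absolute values of the entries of a row on either side of
  the diagonal sum to at most half of the diagonal entry. The recursion then turns a bound
  \<open>(t - 1) / t\<close> for the ratios at the predecessors into the bound \<open>t / (t + 1)\<close> at the point itself
  (\<open>pivot_bound\<close>). As the stencils reach no further than two points, the level \<open>t = 3 i + j\<close> of a point
  \<open>(i, j)\<close> exceeds that of all its predecessors by at least \<open>1\<close>. The level is thus an admissible \<open>t\<close>,
  and unlike the lexicographic rank it grows only linearly with the number of points
  in a row or column. The resulting bound for the condition number is \<open>3 n\<^sub>x + n\<^sub>y + 1\<close>, which is \<open>O(1/h)\<close>.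
\<close>

section \<open>Quadratic forms of a matrix and its modified incomplete factorization\<close>

text \<open>The right-hand side makes two properties of the left-hand one evident: it is nonnegative when
the weights have equal sign, and it does not change when all \<open>x i\<close> are shifted by a constant.\<close>
lemma weighted_variance:
  fixes w x :: "'i \<Rightarrow> real"
  shows "2 * ((\<Sum>i\<in>I. w i) * (\<Sum>i\<in>I. w i * (x i)\<^sup>2) - (\<Sum>i\<in>I. w i * x i)\<^sup>2)
    = (\<Sum>i\<in>I. \<Sum>j\<in>I. w i * w j * (x i - x j)\<^sup>2)"
proof -
  have "w i * w j * (x i - x j)\<^sup>2
      = (w i * (x i)\<^sup>2) * w j + w i * (w j * (x j)\<^sup>2) - 2 * ((w i * x i) * (w j * x j))" for i j
    by (simp add: algebra_simps power2_eq_square)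
  then have "(\<Sum>i\<in>I. \<Sum>j\<in>I. w i * w j * (x i - x j)\<^sup>2)
    = (\<Sum>i\<in>I. \<Sum>j\<in>I. (w i * (x i)\<^sup>2) * w j) + (\<Sum>i\<in>I. \<Sum>j\<in>I. w i * (w j * (x j)\<^sup>2))
      - 2 * (\<Sum>i\<in>I. \<Sum>j\<in>I. (w i * x i) * (w j * x j))"
    by (simp only: sum.distrib sum_subtractf sum_distrib_left)
  also have "\<dots> = 2 * ((\<Sum>i\<in>I. w i) * (\<Sum>i\<in>I. w i * (x i)\<^sup>2) - (\<Sum>i\<in>I. w i * x i)\<^sup>2)"
    by (simp add: power2_eq_square flip: sum_product)
  finally show ?thesis by simp
qed

lemma sum_upper_triangle_swap:
  fixes f :: "nat \<Rightarrow> nat \<Rightarrow> 'a::comm_monoid_add"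
  shows "(\<Sum>k<N. \<Sum>l\<in>{k<..<N}. f k l) = (\<Sum>l<N. \<Sum>k<l. f k l)"
proof -
  have "(\<Sum>k<N. \<Sum>l\<in>{k<..<N}. f k l) = (\<Sum>k\<in>{..<N}. \<Sum>l\<in>{l\<in>{..<N}. k < l}. f k l)"
    by (intro sum.cong) auto
  also have "\<dots> = (\<Sum>l\<in>{..<N}. \<Sum>k\<in>{k\<in>{..<N}. k < l}. f k l)"
    by (rule sum.swap_restrict) auto
  also have "\<dots> = (\<Sum>l<N. \<Sum>k<l. f k l)"
    by (intro sum.cong) auto
  finally show ?thesis .
qed

lemma sum_row_split:
  fixes g :: "nat \<Rightarrow> 'a::comm_monoid_add"
  assumes "k < N"
  shows "(\<Sum>l<N. g l) = (\<Sum>l<k. g l) + g k + (\<Sum>l\<in>{k<..<N}. g l)"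
proof -
  have "{..<N} = insert k ({..<k} \<union> {k<..<N})" using assms by auto
  moreover have "sum g ({..<k} \<union> {k<..<N}) = sum g {..<k} + sum g {k<..<N}"
    by (rule sum.union_disjoint) auto
  ultimately show ?thesis by (simp add: ac_simps)
qed

lemma sum_square_split:
  fixes f :: "nat \<Rightarrow> nat \<Rightarrow> 'a::comm_monoid_add"
  shows "(\<Sum>k<N. \<Sum>l<N. f k l) = (\<Sum>k<N. f k k) + (\<Sum>k<N. \<Sum>l\<in>{k<..<N}. f k l + f l k)"
proof -
  have "(\<Sum>k<N. \<Sum>l<N. f k l)
      = (\<Sum>k<N. (\<Sum>l<k. f k l) + f k k + (\<Sum>l\<in>{k<..<N}. f k l))"
    by (intro sum.cong refl sum_row_split) auto
  then show ?thesis
    by (simp add: sum.distrib sum_upper_triangle_swap[of "\<lambda>k l. f l k"] ac_simps)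
qed

text \<open>The grid points enter only through their lexicographic rank. Sums over predecessors and
successors become sums over all smaller and all larger ranks, since the further terms carry a
zero matrix entry as a factor.\<close>
locale milu_recursion =
  fixes N :: nat and a :: "nat \<Rightarrow> nat \<Rightarrow> real" and e :: "nat \<Rightarrow> real"
  assumes sym: "\<lbrakk>k < N; l < N\<rbrakk> \<Longrightarrow> a k l = a l k"
    and offdiag: "\<lbrakk>k < N; l < N; k \<noteq> l\<rbrakk> \<Longrightarrow> a k l \<le> 0"
    and diag: "k < N \<Longrightarrow> e k = a k k - (\<Sum>m<k. \<Sum>l\<in>{m<..<N}. a k m * a m l / e m)"
begin

definition upper_sum :: "nat \<Rightarrow> real" where
  "upper_sum m = (\<Sum>l\<in>{m<..<N}. - a m l)"

lemma diag_upper_sum: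
  assumes "k < N"
  shows "e k = a k k - (\<Sum>m<k. - a k m * (upper_sum m / e m))"
  unfolding diag[OF assms]
  by (intro arg_cong2[of _ _ _ _ minus] sum.cong)
    (auto simp: upper_sum_def sum_negf simp flip: sum_distrib_left sum_divide_distrib)

text \<open>The reason for the condition number \<open>O(1/h)\<close>. Without boundary, a row whose entries to the left
and to the right of the diagonal both sum to \<open>- \<sigma>\<close> has the constant solution \<open>e = \<sigma>\<close>, for which the
ratio \<open>upper_sum / e\<close> is \<open>1\<close>. The boundary pushes the ratio below \<open>1\<close>, and this gain decays only
slowly: if all predecessors have a ratio of at most \<open>f (t - 1)\<close>, then the ratio at level \<open>t\<close> is at
most \<open>1 / (2 - f (t - 1))\<close>, and \<open>f t = t / (t + 1)\<close> solves \<open>f t = 1 / (2 - f (t - 1))\<close>. The level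
only has to be at least \<open>1\<close> and to exceed the level of every predecessor by at least \<open>1\<close>.\<close>
lemma pivot_bound:
  fixes level :: "nat \<Rightarrow> real"
  assumes "0 < \<sigma>"
    and diag_eq: "\<And>k. k < N \<Longrightarrow> a k k = 2 * \<sigma>"
    and lower: "\<And>k. k < N \<Longrightarrow> (\<Sum>m<k. - a k m) \<le> \<sigma>"
    and upper: "\<And>k. k < N \<Longrightarrow> upper_sum k \<le> \<sigma>"
    and level_ge: "\<And>k. k < N \<Longrightarrow> 1 \<le> level k"
    and level_step: "\<And>k m. \<lbrakk>k < N; m < k; a k m \<noteq> 0\<rbrakk> \<Longrightarrow> level m + 1 \<le> level k"
    and "k < N"
  shows "0 < e k \<and> upper_sum k \<le> level k / (level k + 1) * e k"
  using \<open>k < N\<close>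
proof (induction k rule: less_induct)
  case (less k)
  \<comment> \<open>An upper bound for the ratios of all predecessors: the extremal function at the level below.\<close>
  define r where "r = (level k - 1) / level k"
  have lev: "1 \<le> level k" using level_ge less.prems by simp
  have "- a k m * (upper_sum m / e m) \<le> - a k m * r" if "m < k" for m
  proof (cases "a k m = 0")
    case False
    have m: "m < N" using that less.prems by simp
    have IH: "0 < e m" "upper_sum m \<le> level m / (level m + 1) * e m"
      using less.IH[OF that m] by auto
    then have "upper_sum m / e m \<le> level m / (level m + 1)"
      by (simp add: pos_divide_le_eq)
    also have "\<dots> \<le> r"
      using level_ge[OF m] level_step[OF less.prems that False] unfolding r_def
      by (simp add: field_simps)
    finally show ?thesis
      using offdiag[OF less.prems m] that by (intro mult_left_mono) auto
  qed simp
  then have "(\<Sum>m<k. - a k m * (upper_sum m / e m)) \<le> (\<Sum>m<k. - a k m * r)"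
    by (intro sum_mono) auto
  also have "\<dots> = (\<Sum>m<k. - a k m) * r" by (simp only: sum_distrib_right)
  also have "\<dots> \<le> \<sigma> * r"
    using lower[OF less.prems] lev by (intro mult_right_mono) (auto simp: r_def)
  finally have "2 * \<sigma> - \<sigma> * r \<le> e k"
    using diag_upper_sum[OF less.prems] diag_eq[OF less.prems] by simp
  moreover have "2 * \<sigma> - \<sigma> * r = \<sigma> * ((level k + 1) / level k)"
    using lev by (simp add: r_def field_simps)
  ultimately have e: "\<sigma> * ((level k + 1) / level k) \<le> e k" by simp
  moreover have "0 < \<sigma> * ((level k + 1) / level k)" using lev \<open>0 < \<sigma>\<close> by simp
  ultimately have "0 < e k" by linarith
  have "upper_sum k \<le> level k / (level k + 1) * (\<sigma> * ((level k + 1) / level k))"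
    using upper[OF less.prems] lev by simp
  also have "\<dots> \<le> level k / (level k + 1) * e k"
    using e lev by (intro mult_left_mono) auto
  finally show ?case using \<open>0 < e k\<close> by simp
qed

end

text \<open>The hypotheses of the spectral comparison of a matrix with its modified incomplete factorization:
\<open>\<tau>\<close> bounds the ratios of the absolute row sums of the strict upper triangle to the pivots.\<close>
locale milu_factorization = milu_recursion +
  fixes \<tau> :: real
  assumes row_sum: "k < N \<Longrightarrow> 0 \<le> (\<Sum>l<N. a k l)"
    and pos: "k < N \<Longrightarrow> 0 < e k"
    and upper_row: "k < N \<Longrightarrow> upper_sum k \<le> \<tau> * e k"
    and less_one: "\<tau> < 1"
begin

definition A_form :: "(nat \<Rightarrow> real) \<Rightarrow> real" where
  "A_form x = (\<Sum>k<N. \<Sum>l<N. a k l * x k * x l)"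

text \<open>The \<open>m\<close>-th entry of \<open>(L + E)\<^sup>T x\<close>, so that \<open>M_form x\<close> below is \<open>x\<^sup>T M x\<close>.\<close>
definition factor :: "(nat \<Rightarrow> real) \<Rightarrow> nat \<Rightarrow> real" where
  "factor x m = e m * x m + (\<Sum>l\<in>{m<..<N}. a m l * x l)"

definition M_form :: "(nat \<Rightarrow> real) \<Rightarrow> real" where
  "M_form x = (\<Sum>m<N. (factor x m)\<^sup>2 / e m)"

text \<open>Up to the factor \<open>(upper_sum m)\<^sup>2\<close>, this is the variance of the values of \<open>x\<close> at the successors
of \<open>m\<close>, each weighted by the absolute value of its matrix entry.\<close>
definition spread :: "(nat \<Rightarrow> real) \<Rightarrow> nat \<Rightarrow> real" where
  "spread x m = upper_sum m * (\<Sum>l\<in>{m<..<N}. - a m l * (x l)\<^sup>2) - (\<Sum>l\<in>{m<..<N}. - a m l * x l)\<^sup>2"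

lemma spread_eq_variance:
  "2 * spread x m = (\<Sum>i\<in>{m<..<N}. \<Sum>j\<in>{m<..<N}. (- a m i) * (- a m j) * (x i - x j)\<^sup>2)"
  using weighted_variance[of "\<lambda>l. - a m l" "{m<..<N}" x] by (simp add: spread_def upper_sum_def)

lemma spread_nonneg:
  assumes "m < N"
  shows "0 \<le> spread x m"
proof -
  have "0 \<le> 2 * spread x m"
    unfolding spread_eq_variance using assms
    by (intro sum_nonneg mult_nonneg_nonneg) (auto intro: offdiag)
  then show ?thesis by simp
qed

text \<open>The variance is at most the second moment about any point; here that point is \<open>x m\<close>, which
turns the bound into the energy of the edges that lead from \<open>m\<close> to its successors.\<close>
lemma spread_le:
  assumes "m < N"
  shows "spread x m \<le> upper_sum m * (\<Sum>l\<in>{m<..<N}. - a m l * (x m - x l)\<^sup>2)"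
proof -
  have "2 * spread x m = 2 * spread (\<lambda>l. x m - x l) m"
    by (simp add: spread_eq_variance power2_commute)
  also have "\<dots> \<le> 2 * (upper_sum m * (\<Sum>l\<in>{m<..<N}. - a m l * (x m - x l)\<^sup>2))"
    by (simp add: spread_def)
  finally show ?thesis by simp
qed

lemma A_form_dirichlet:
  "A_form x = (\<Sum>k<N. (\<Sum>l<N. a k l) * (x k)\<^sup>2)
     + (\<Sum>m<N. \<Sum>l\<in>{m<..<N}. - a m l * (x m - x l)\<^sup>2)"
proof -
  have "A_form x - (\<Sum>k<N. (\<Sum>l<N. a k l) * (x k)\<^sup>2)
      = (\<Sum>k<N. \<Sum>l<N. a k l * (x k * x l - (x k)\<^sup>2))"
    by (simp only: A_form_def right_diff_distrib sum_subtractf sum_distrib_right mult.assoc)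
  also have "\<dots> = (\<Sum>m<N. \<Sum>l\<in>{m<..<N}. - a m l * (x m - x l)\<^sup>2)"
  proof -
    have "a m l * (x m * x l - (x m)\<^sup>2) + a l m * (x l * x m - (x l)\<^sup>2)
        = - a m l * (x m - x l)\<^sup>2" if "m < N" "l \<in> {m<..<N}" for m l
      using that sym[of l m] by (simp add: algebra_simps power2_eq_square)
    moreover have "a k k * (x k * x k - (x k)\<^sup>2) = 0" for k
      by (simp add: power2_eq_square)
    ultimately show ?thesis
      unfolding sum_square_split by (simp cong: sum.cong_simp)
  qed
  finally show ?thesis by simp
qed

text \<open>Fill-in outside the diagonal is compensated on the diagonal so that row sums are kept. Hence
\<open>M - A\<close> has row sums zero, and eliminating the unknown \<open>m\<close> contributes to it the negative of a
graph Laplacian on the successors of \<open>m\<close>, whose quadratic form is \<open>spread x m / e m\<close>.\<close>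
lemma M_form_eq: "M_form x = A_form x - (\<Sum>m<N. spread x m / e m)"
proof -
  have diag_part: "(\<Sum>k<N. e k * (x k)\<^sup>2) = (\<Sum>k<N. a k k * (x k)\<^sup>2)
      - (\<Sum>m<N. upper_sum m * (\<Sum>l\<in>{m<..<N}. - a m l * (x l)\<^sup>2) / e m)"
  proof -
    have "(\<Sum>k<N. e k * (x k)\<^sup>2) = (\<Sum>k<N. a k k * (x k)\<^sup>2
        - (\<Sum>m<k. upper_sum m * (- a m k * (x k)\<^sup>2) / e m))"
    proof (intro sum.cong refl)
      fix k assume "k \<in> {..<N}"
      then have k: "k < N" by simp
      have "e k = a k k - (\<Sum>m<k. upper_sum m * (- a m k) / e m)"
      proof -
        have "- a k m * (upper_sum m / e m) = upper_sum m * (- a m k) / e m" if "m < k" for m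
          using sym[of k m] k that by simp
        then show ?thesis
          unfolding diag_upper_sum[OF k] by (intro arg_cong2[of _ _ _ _ minus] sum.cong refl) auto
      qed
      then have "e k * (x k)\<^sup>2 = (a k k - (\<Sum>m<k. upper_sum m * (- a m k) / e m)) * (x k)\<^sup>2"
        by simp
      also have "\<dots> = a k k * (x k)\<^sup>2 - (\<Sum>m<k. upper_sum m * (- a m k * (x k)\<^sup>2) / e m)"
        unfolding left_diff_distrib sum_distrib_right
        by (intro arg_cong2[of _ _ _ _ minus] sum.cong) auto
      finally show "e k * (x k)\<^sup>2
        = a k k * (x k)\<^sup>2 - (\<Sum>m<k. upper_sum m * (- a m k * (x k)\<^sup>2) / e m)" .
    qed
    also have "\<dots> = (\<Sum>k<N. a k k * (x k)\<^sup>2)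
        - (\<Sum>m<N. \<Sum>l\<in>{m<..<N}. upper_sum m * (- a m l * (x l)\<^sup>2) / e m)"
      by (simp only: sum_subtractf sum_upper_triangle_swap)
    finally show ?thesis
      by (simp only: sum_distrib_left sum_divide_distrib)
  qed
  have "M_form x = (\<Sum>m<N. e m * (x m)\<^sup>2 + 2 * (\<Sum>l\<in>{m<..<N}. a m l * x m * x l)
      + (\<Sum>l\<in>{m<..<N}. - a m l * x l)\<^sup>2 / e m)"
    unfolding M_form_def
  proof (intro sum.cong refl)
    fix m assume "m \<in> {..<N}"
    then have "0 < e m" using pos by simp
    define t where "t = (\<Sum>l\<in>{m<..<N}. a m l * x l)"
    have t: "(\<Sum>l\<in>{m<..<N}. a m l * x m * x l) = x m * t" "(\<Sum>l\<in>{m<..<N}. - a m l * x l) = - t"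
      by (simp_all add: t_def sum_distrib_left sum_negf mult_ac)
    show "(factor x m)\<^sup>2 / e m = e m * (x m)\<^sup>2 + 2 * (\<Sum>l\<in>{m<..<N}. a m l * x m * x l)
      + (\<Sum>l\<in>{m<..<N}. - a m l * x l)\<^sup>2 / e m"
      unfolding t factor_def t_def[symmetric] using \<open>0 < e m\<close>
      by (simp add: field_simps power2_eq_square)
  qed
  also have "\<dots> = (\<Sum>m<N. e m * (x m)\<^sup>2) + (\<Sum>m<N. \<Sum>l\<in>{m<..<N}. 2 * (a m l * x m * x l))
      + (\<Sum>m<N. (\<Sum>l\<in>{m<..<N}. - a m l * x l)\<^sup>2 / e m)"
    by (simp add: sum.distrib sum_distrib_left)
  also have "(\<Sum>m<N. \<Sum>l\<in>{m<..<N}. 2 * (a m l * x m * x l))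
      = A_form x - (\<Sum>k<N. a k k * (x k)\<^sup>2)"
  proof -
    have "(\<Sum>m<N. \<Sum>l\<in>{m<..<N}. a m l * x m * x l + a l m * x l * x m)
        = (\<Sum>m<N. \<Sum>l\<in>{m<..<N}. 2 * (a m l * x m * x l))"
      using sym by (intro sum.cong refl) simp
    then show ?thesis
      unfolding A_form_def sum_square_split by (simp only: power2_eq_square mult.assoc)
  qed
  finally show ?thesis
    unfolding diag_part spread_def by (simp add: sum_subtractf diff_divide_distrib)
qed

lemma M_form_le_A_form: "M_form x \<le> A_form x"
  unfolding M_form_eq using spread_nonneg pos
  by (auto intro!: sum_nonneg divide_nonneg_pos)

text \<open>The defect \<open>A - M\<close> consumes at most the fraction \<open>\<tau>\<close> of the energy of the edges, and by the
nonnegative row sums this energy is at most \<open>A_form x\<close>.\<close>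
lemma A_form_le_M_form: "(1 - \<tau>) * A_form x \<le> M_form x"
proof -
  let ?d = "\<lambda>m. \<Sum>l\<in>{m<..<N}. - a m l * (x m - x l)\<^sup>2"
  have "spread x m / e m \<le> \<tau> * ?d m" if "m < N" for m
  proof -
    have "0 \<le> ?d m"
      using that by (intro sum_nonneg mult_nonneg_nonneg) (auto intro: offdiag)
    then have "spread x m \<le> (\<tau> * e m) * ?d m"
      using spread_le[OF that, of x] upper_row[OF that]
      by (meson mult_right_mono order_trans)
    then show ?thesis using pos[OF that] by (simp add: field_simps)
  qed
  then have "(\<Sum>m<N. spread x m / e m) \<le> \<tau> * (\<Sum>m<N. ?d m)"
    unfolding sum_distrib_left[of \<tau>] by (intro sum_mono) auto
  also have "\<dots> \<le> \<tau> * A_form x"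
  proof (cases "N = 0")
    case True
    then show ?thesis unfolding A_form_def by simp
  next
    case False
    then have N: "0 < N" by simp
    \<comment> \<open>The first row shows that the bound on the ratios is nonnegative.\<close>
    have "0 \<le> (\<Sum>l\<in>{0<..<N}. - a 0 l)" by (rule sum_nonneg) (use N in \<open>auto intro: offdiag\<close>)
    then have "0 \<le> \<tau> * e 0" using upper_row[OF N] unfolding upper_sum_def by linarith
    then have "0 \<le> \<tau>" using pos[OF N] by (simp add: zero_le_mult_iff)
    moreover have "(\<Sum>m<N. ?d m) \<le> A_form x"
      unfolding A_form_dirichlet by (auto intro!: sum_nonneg mult_nonneg_nonneg row_sum)
    ultimately show ?thesis by (rule mult_left_mono[rotated])
  qed
  finally have "(\<Sum>m<N. spread x m / e m) \<le> \<tau> * A_form x" .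
  then show ?thesis unfolding M_form_eq by (simp add: algebra_simps)
qed

text \<open>At the last nonzero entry of \<open>x\<close> the triangular factor reduces to the pivot.\<close>
lemma M_form_pos:
  assumes "k < N" "x k \<noteq> 0"
  shows "0 < M_form x"
proof -
  have "finite {k. k < N \<and> x k \<noteq> 0}" by simp
  moreover have "{k. k < N \<and> x k \<noteq> 0} \<noteq> {}" using assms by auto
  ultimately obtain m where m: "m < N" "x m \<noteq> 0" and last: "\<forall>l. l < N \<and> x l \<noteq> 0 \<longrightarrow> l \<le> m"
    using Max_in[of "{k. k < N \<and> x k \<noteq> 0}"] Max_ge[of "{k. k < N \<and> x k \<noteq> 0}"] by blast
  have "factor x m = e m * x m"
    unfolding factor_def using last by (auto intro!: sum.neutral)
  then have "0 < (factor x m)\<^sup>2 / e m" using m pos[of m] by simp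
  then show ?thesis
    unfolding M_form_def using m pos
    by (intro sum_pos2[of _ m]) (auto intro: divide_nonneg_pos)
qed

end

section \<open>Eigenvalues of a definite pencil\<close>

lemma scalar_prod_sum:
  "w \<in> carrier_vec n \<Longrightarrow> v \<bullet> w = (\<Sum>i<n. v $ i * w $ i)"
  by (simp add: scalar_prod_def lessThan_atLeast0)

lemma mult_mat_vec_sum:
  "\<lbrakk>X \<in> carrier_mat n n; v \<in> carrier_vec n; i < n\<rbrakk>
    \<Longrightarrow> (X *\<^sub>v v) $ i = (\<Sum>j<n. X $$ (i, j) * v $ j)"
  by (simp add: scalar_prod_def lessThan_atLeast0)

lemma mat_inv_inverse:
  assumes X: "X \<in> carrier_mat n n"
    and inj: "\<And>v. \<lbrakk>v \<in> carrier_vec n; X *\<^sub>v v = 0\<^sub>v n\<rbrakk> \<Longrightarrow> v = 0\<^sub>v n"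
  shows "mat_inv X \<in> carrier_mat n n" "X * mat_inv X = 1\<^sub>m n" "mat_inv X * X = 1\<^sub>m n"
proof -
  have "det X \<noteq> 0" using inj det_0_iff_vec_prod_zero[OF X] by auto
  then have "X \<in> Units (ring_mat TYPE(real) n ())" by (rule det_non_zero_imp_unit[OF X])
  then obtain Y where "mat_inverse X = Some Y"
    using mat_inverse(1)[OF X, where b = "()"] by (cases "mat_inverse X") auto
  then show "mat_inv X \<in> carrier_mat n n" "X * mat_inv X = 1\<^sub>m n" "mat_inv X * X = 1\<^sub>m n"
    using mat_inverse(2)[OF X] by (simp_all add: mat_inv_def)
qed

text \<open>The eigenvalues of \<open>M\<^sup>-\<^sup>1 A\<close> are those of the pencil \<open>A v = \<mu> M v\<close>, hence they are controlled by
the Rayleigh quotients of the two forms although \<open>M\<^sup>-\<^sup>1 A\<close> itself is not symmetric.\<close>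
locale definite_pencil =
  fixes n :: nat and A M :: "real mat"
  assumes A: "A \<in> carrier_mat n n" and M: "M \<in> carrier_mat n n"
    and A_sym: "\<lbrakk>u \<in> carrier_vec n; v \<in> carrier_vec n\<rbrakk> \<Longrightarrow> u \<bullet> (A *\<^sub>v v) = v \<bullet> (A *\<^sub>v u)"
    and M_sym: "\<lbrakk>u \<in> carrier_vec n; v \<in> carrier_vec n\<rbrakk> \<Longrightarrow> u \<bullet> (M *\<^sub>v v) = v \<bullet> (M *\<^sub>v u)"
    and M_pos: "\<lbrakk>v \<in> carrier_vec n; v \<noteq> 0\<^sub>v n\<rbrakk> \<Longrightarrow> 0 < v \<bullet> (M *\<^sub>v v)"
begin

lemma M_inverse:
  "mat_inv M \<in> carrier_mat n n" "M * mat_inv M = 1\<^sub>m n" "mat_inv M * M = 1\<^sub>m n"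
proof -
  have "v = 0\<^sub>v n" if "v \<in> carrier_vec n" "M *\<^sub>v v = 0\<^sub>v n" for v
    using M_pos[OF that(1)] that by force
  then show "mat_inv M \<in> carrier_mat n n" "M * mat_inv M = 1\<^sub>m n" "mat_inv M * M = 1\<^sub>m n"
    using mat_inv_inverse[OF M] by auto
qed

abbreviation "X \<equiv> mat_inv M * A"

lemma X_carrier: "X \<in> carrier_mat n n"
  using M_inverse(1) A by simp

lemma M_mult_X:
  assumes "v \<in> carrier_vec n"
  shows "M *\<^sub>v (X *\<^sub>v v) = A *\<^sub>v v"
proof -
  have "M *\<^sub>v (X *\<^sub>v v) = (M * X) *\<^sub>v v"
    using M X_carrier assms by (simp add: assoc_mult_mat_vec)
  also have "M * X = A"
    using M M_inverse A by (simp flip: assoc_mult_mat[of _ n n _ n _ n])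
  finally show ?thesis .
qed

lemma eigenvalue_bounds:
  assumes lo: "\<And>v. v \<in> carrier_vec n \<Longrightarrow> lo * (v \<bullet> (M *\<^sub>v v)) \<le> v \<bullet> (A *\<^sub>v v)"
    and hi: "\<And>v. v \<in> carrier_vec n \<Longrightarrow> v \<bullet> (A *\<^sub>v v) \<le> hi * (v \<bullet> (M *\<^sub>v v))"
    and \<mu>: "\<mu> \<in> spectrum X"
  shows "lo \<le> \<mu>" "\<mu> \<le> hi"
proof -
  obtain v where v: "v \<in> carrier_vec n" "v \<noteq> 0\<^sub>v n" "X *\<^sub>v v = \<mu> \<cdot>\<^sub>v v"
    using \<mu> X_carrier by (auto simp: spectrum_def eigenvalue_def eigenvector_def)
  have "A *\<^sub>v v = \<mu> \<cdot>\<^sub>v (M *\<^sub>v v)"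
    using M_mult_X[OF v(1)] v M by (simp add: mult_mat_vec)
  then have "v \<bullet> (A *\<^sub>v v) = \<mu> * (v \<bullet> (M *\<^sub>v v))"
    using v M by simp
  then show "lo \<le> \<mu>" "\<mu> \<le> hi"
    using lo[OF v(1)] hi[OF v(1)] M_pos[OF v(1,2)] by simp_all
qed

text \<open>A complex eigenvalue exists, and it is real because both quadratic forms are symmetric: for an
eigenvector \<open>x + \<i> y\<close> to \<open>\<alpha> + \<i> \<beta>\<close>, comparing \<open>y\<^sup>T A x\<close> with \<open>x\<^sup>T A y\<close> leaves
\<open>\<beta> (x\<^sup>T M x + y\<^sup>T M y) = 0\<close>. Then \<open>x\<close> and \<open>y\<close> satisfy the real eigenvalue equation, and one of them
is nonzero.\<close>
lemma spectrum_nonempty: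
  assumes "0 < n"
  shows "spectrum X \<noteq> {}"
proof -
  let ?C = "map_mat complex_of_real X"
  have C: "?C \<in> carrier_mat n n" using X_carrier by simp
  obtain c z where z: "z \<in> carrier_vec n" "z \<noteq> 0\<^sub>v n" "?C *\<^sub>v z = c \<cdot>\<^sub>v z"
    using spectrum_non_empty[OF C assms] X_carrier
    by (auto simp: spectrum_def eigenvalue_def eigenvector_def)
  define \<alpha> \<beta> where "\<alpha> = Re c" and "\<beta> = Im c"
  define x y where "x = map_vec Re z" and "y = map_vec Im z"
  have carr: "x \<in> carrier_vec n" "y \<in> carrier_vec n"
    using z by (auto simp: x_def y_def)
  have row: "(\<Sum>j<n. complex_of_real (X $$ (i, j)) * z $ j) = c * z $ i" if "i < n" for i
  proof -
    have "(\<Sum>j<n. complex_of_real (X $$ (i, j)) * z $ j) = (?C *\<^sub>v z) $ i"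
      using that A M_inverse(1) by (subst mult_mat_vec_sum[OF C z(1)]) (auto intro!: sum.cong)
    then show ?thesis using that z by simp
  qed
  have re: "X *\<^sub>v x = \<alpha> \<cdot>\<^sub>v x - \<beta> \<cdot>\<^sub>v y"
  proof (rule eq_vecI)
    fix i assume "i < dim_vec (\<alpha> \<cdot>\<^sub>v x - \<beta> \<cdot>\<^sub>v y)"
    then have i: "i < n" using carr by simp
    have "(X *\<^sub>v x) $ i = Re (\<Sum>j<n. complex_of_real (X $$ (i, j)) * z $ j)"
      unfolding mult_mat_vec_sum[OF X_carrier carr(1) i] using z(1) by (auto simp: x_def intro!: sum.cong)
    then show "(X *\<^sub>v x) $ i = (\<alpha> \<cdot>\<^sub>v x - \<beta> \<cdot>\<^sub>v y) $ i"
      unfolding row[OF i] using i z(1) by (simp add: x_def y_def \<alpha>_def \<beta>_def)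
  qed (use M_inverse(1) A carr in simp)
  have im: "X *\<^sub>v y = \<alpha> \<cdot>\<^sub>v y + \<beta> \<cdot>\<^sub>v x"
  proof (rule eq_vecI)
    fix i assume "i < dim_vec (\<alpha> \<cdot>\<^sub>v y + \<beta> \<cdot>\<^sub>v x)"
    then have i: "i < n" using carr by simp
    have "(X *\<^sub>v y) $ i = Im (\<Sum>j<n. complex_of_real (X $$ (i, j)) * z $ j)"
      unfolding mult_mat_vec_sum[OF X_carrier carr(2) i] using z(1) by (auto simp: y_def intro!: sum.cong)
    then show "(X *\<^sub>v y) $ i = (\<alpha> \<cdot>\<^sub>v y + \<beta> \<cdot>\<^sub>v x) $ i"
      unfolding row[OF i] using i z(1) by (simp add: x_def y_def \<alpha>_def \<beta>_def)
  qed (use M_inverse(1) A carr in simp)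
  have Mc: "M *\<^sub>v x \<in> carrier_vec n" "M *\<^sub>v y \<in> carrier_vec n"
    using M carr by auto
  have "A *\<^sub>v x = \<alpha> \<cdot>\<^sub>v (M *\<^sub>v x) - \<beta> \<cdot>\<^sub>v (M *\<^sub>v y)"
    using M_mult_X[OF carr(1)] carr M
    by (simp add: re mult_mat_vec mult_minus_distrib_mat_vec)
  moreover have "A *\<^sub>v y = \<alpha> \<cdot>\<^sub>v (M *\<^sub>v y) + \<beta> \<cdot>\<^sub>v (M *\<^sub>v x)"
    using M_mult_X[OF carr(2)] carr M
    by (simp add: im mult_mat_vec mult_add_distrib_mat_vec)
  moreover have "y \<bullet> (A *\<^sub>v x) = x \<bullet> (A *\<^sub>v y)"
    using A_sym carr by simp
  ultimately have "\<alpha> * (y \<bullet> (M *\<^sub>v x)) - \<beta> * (y \<bullet> (M *\<^sub>v y))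
      = \<alpha> * (x \<bullet> (M *\<^sub>v y)) + \<beta> * (x \<bullet> (M *\<^sub>v x))"
    using carr Mc by (simp add: scalar_prod_minus_distrib scalar_prod_add_distrib)
  then have key: "\<beta> * (x \<bullet> (M *\<^sub>v x) + y \<bullet> (M *\<^sub>v y)) = 0"
    using M_sym[OF carr] by (simp add: algebra_simps)
  have nonneg: "0 \<le> v \<bullet> (M *\<^sub>v v)" if "v \<in> carrier_vec n" for v
    using M_pos[OF that] M by (cases "v = 0\<^sub>v n") auto
  have nz: "x \<noteq> 0\<^sub>v n \<or> y \<noteq> 0\<^sub>v n"
  proof (rule ccontr)
    assume "\<not> ?thesis"
    then have "Re (z $ i) = 0 \<and> Im (z $ i) = 0" if "i < n" for i
      using that z(1) by (metis carrier_vecD index_map_vec(1) index_zero_vec(1) x_def y_def)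
    then have "z = 0\<^sub>v n" using z(1) by (intro eq_vecI) (auto simp: complex_eq_iff)
    with z(2) show False by simp
  qed
  then have "0 < x \<bullet> (M *\<^sub>v x) + y \<bullet> (M *\<^sub>v y)"
    using M_pos nonneg carr by (metis add_nonneg_pos add_pos_nonneg)
  with key have "\<beta> = 0" by simp
  then have "X *\<^sub>v x = \<alpha> \<cdot>\<^sub>v x" "X *\<^sub>v y = \<alpha> \<cdot>\<^sub>v y"
    using re im carr by auto
  with nz carr X_carrier have "eigenvalue X \<alpha>"
    unfolding eigenvalue_def eigenvector_def by fastforce
  then show ?thesis by (auto simp: spectrum_def)
qed

lemma kappa_bound:
  assumes "0 < n" "0 < lo"
    and lo: "\<And>v. v \<in> carrier_vec n \<Longrightarrow> lo * (v \<bullet> (M *\<^sub>v v)) \<le> v \<bullet> (A *\<^sub>v v)"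
    and hi: "\<And>v. v \<in> carrier_vec n \<Longrightarrow> v \<bullet> (A *\<^sub>v v) \<le> hi * (v \<bullet> (M *\<^sub>v v))"
  shows "0 \<le> kappa X" "kappa X \<le> hi / lo"
proof -
  have fin: "finite (spectrum X)" "spectrum X \<noteq> {}"
    using card_finite_spectrum(1)[OF X_carrier] spectrum_nonempty[OF \<open>0 < n\<close>] by auto
  then have "lo \<le> Min (spectrum X)" "lo \<le> Max (spectrum X)" "Max (spectrum X) \<le> hi"
    using eigenvalue_bounds[OF lo hi] by auto
  then show "0 \<le> kappa X" "kappa X \<le> hi / lo"
    using \<open>0 < lo\<close> by (auto simp: kappa_def intro: frac_le)
qed

end

section \<open>The condition number of a modified incomplete factorization\<close>

context milu_factorization
begin

definition A_mat :: "real mat" where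
  "A_mat = mat N N (\<lambda>(k, l). a k l)"

definition E_mat :: "real mat" where
  "E_mat = mat N N (\<lambda>(k, l). if k = l then e k else 0)"

text \<open>The lower triangular factor \<open>L + E\<close> of the preconditioner.\<close>
definition F_mat :: "real mat" where
  "F_mat = mat N N (\<lambda>(k, l). if l < k then a k l else if k = l then e k else 0)"

definition M_mat :: "real mat" where
  "M_mat = F_mat * mat_inv E_mat * transpose_mat F_mat"

lemma carrier: "A_mat \<in> carrier_mat N N" "E_mat \<in> carrier_mat N N" "F_mat \<in> carrier_mat N N"
  by (simp_all add: A_mat_def E_mat_def F_mat_def)

lemma E_mat_mult:
  assumes "v \<in> carrier_vec N" "i < N"
  shows "(E_mat *\<^sub>v v) $ i = e i * v $ i"
proof -
  have "(E_mat *\<^sub>v v) $ i = (\<Sum>j<N. if j = i then e i * v $ j else 0)"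
    unfolding mult_mat_vec_sum[OF carrier(2) assms]
    using assms by (intro sum.cong) (auto simp: E_mat_def)
  then show ?thesis using assms by simp
qed

lemma E_inverse: "mat_inv E_mat \<in> carrier_mat N N" "E_mat * mat_inv E_mat = 1\<^sub>m N"
proof -
  have "v = 0\<^sub>v N" if v: "v \<in> carrier_vec N" "E_mat *\<^sub>v v = 0\<^sub>v N" for v
  proof (rule eq_vecI)
    fix i assume "i < dim_vec (0\<^sub>v N :: real vec)"
    then have "i < N" by simp
    then show "v $ i = 0\<^sub>v N $ i" using E_mat_mult[OF v(1), of i] v(2) pos[of i] by simp
  qed (use v in simp)
  then show "mat_inv E_mat \<in> carrier_mat N N" "E_mat * mat_inv E_mat = 1\<^sub>m N"
    using mat_inv_inverse[OF carrier(2)] by auto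
qed

lemma E_inverse_mult:
  assumes "v \<in> carrier_vec N" "i < N"
  shows "(mat_inv E_mat *\<^sub>v v) $ i = v $ i / e i"
proof -
  have "E_mat *\<^sub>v (mat_inv E_mat *\<^sub>v v) = v"
    using carrier(2) E_inverse assms by (simp flip: assoc_mult_mat_vec)
  then have "e i * (mat_inv E_mat *\<^sub>v v) $ i = v $ i"
    using E_mat_mult[of "mat_inv E_mat *\<^sub>v v" i] E_inverse(1) assms by simp
  then show ?thesis using pos[OF assms(2)] by (simp add: field_simps)
qed

lemma F_transpose_mult:
  assumes "v \<in> carrier_vec N" "m < N"
  shows "(transpose_mat F_mat *\<^sub>v v) $ m = factor (($) v) m"
proof -
  have "(transpose_mat F_mat *\<^sub>v v) $ m = (\<Sum>l<N. F_mat $$ (l, m) * v $ l)"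
    using assms carrier(3) by (subst mult_mat_vec_sum) (auto intro!: sum.cong)
  also have "\<dots> = e m * v $ m + (\<Sum>l\<in>{m<..<N}. F_mat $$ (l, m) * v $ l)"
    unfolding sum_row_split[OF assms(2)] using assms(2) by (simp add: F_mat_def)
  also have "\<dots> = factor (($) v) m"
    unfolding factor_def using assms(2)
    by (intro arg_cong2[of _ _ _ _ plus] sum.cong refl) (auto simp: F_mat_def sym[of m])
  finally show ?thesis .
qed

lemma M_mat_carrier: "M_mat \<in> carrier_mat N N"
  unfolding M_mat_def using carrier(3) E_inverse(1) by simp

lemma scalar_prod_M_mat:
  assumes u: "u \<in> carrier_vec N" and v: "v \<in> carrier_vec N"
  shows "u \<bullet> (M_mat *\<^sub>v v) = (\<Sum>m<N. factor (($) u) m * factor (($) v) m / e m)"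
proof -
  let ?y = "transpose_mat F_mat *\<^sub>v v"
  have y: "?y \<in> carrier_vec N" using carrier(3) v by simp
  have z: "mat_inv E_mat *\<^sub>v ?y \<in> carrier_vec N" using E_inverse(1) y by simp
  have "M_mat *\<^sub>v v = F_mat *\<^sub>v (mat_inv E_mat *\<^sub>v ?y)"
    unfolding M_mat_def using carrier(3) E_inverse(1) v y
    by (simp add: assoc_mult_mat_vec[of _ N N _ N])
  then have "u \<bullet> (M_mat *\<^sub>v v) = (transpose_mat F_mat *\<^sub>v u) \<bullet> (mat_inv E_mat *\<^sub>v ?y)"
    using transpose_vec_mult_scalar[OF carrier(3) z u] by simp
  also have "\<dots> = (\<Sum>m<N. factor (($) u) m * factor (($) v) m / e m)"
    unfolding scalar_prod_sum[OF z]
    using y by (intro sum.cong) (simp_all add: E_inverse_mult F_transpose_mult u v del: index_mult_mat_vec)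
  finally show ?thesis .
qed

lemma scalar_prod_M_mat_self:
  "v \<in> carrier_vec N \<Longrightarrow> v \<bullet> (M_mat *\<^sub>v v) = M_form (($) v)"
  by (simp add: scalar_prod_M_mat M_form_def power2_eq_square)

lemma scalar_prod_A_mat:
  assumes "u \<in> carrier_vec N" "v \<in> carrier_vec N"
  shows "u \<bullet> (A_mat *\<^sub>v v) = (\<Sum>k<N. \<Sum>l<N. a k l * u $ k * v $ l)"
proof -
  have Av: "A_mat *\<^sub>v v \<in> carrier_vec N" using carrier(1) assms by simp
  have "u \<bullet> (A_mat *\<^sub>v v) = (\<Sum>k<N. u $ k * (\<Sum>l<N. A_mat $$ (k, l) * v $ l))"
    unfolding scalar_prod_sum[OF Av]
    by (intro sum.cong refl arg_cong2[of _ _ _ _ times] mult_mat_vec_sum[OF carrier(1) assms(2)]) simp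
  also have "\<dots> = (\<Sum>k<N. \<Sum>l<N. a k l * u $ k * v $ l)"
    unfolding sum_distrib_left by (intro sum.cong refl) (simp add: A_mat_def)
  finally show ?thesis .
qed

lemma scalar_prod_A_mat_self:
  "v \<in> carrier_vec N \<Longrightarrow> v \<bullet> (A_mat *\<^sub>v v) = A_form (($) v)"
  by (simp add: scalar_prod_A_mat A_form_def)

sublocale definite_pencil N A_mat M_mat
proof
  fix u v :: "real vec"
  assume u: "u \<in> carrier_vec N" and v: "v \<in> carrier_vec N"
  have "(\<Sum>k<N. \<Sum>l<N. a k l * u $ k * v $ l) = (\<Sum>l<N. \<Sum>k<N. a k l * u $ k * v $ l)"
    by (rule sum.swap)
  also have "\<dots> = (\<Sum>l<N. \<Sum>k<N. a l k * v $ l * u $ k)"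
    using sym by (intro sum.cong refl) simp
  finally show "u \<bullet> (A_mat *\<^sub>v v) = v \<bullet> (A_mat *\<^sub>v u)"
    by (simp add: scalar_prod_A_mat u v)
  show "u \<bullet> (M_mat *\<^sub>v v) = v \<bullet> (M_mat *\<^sub>v u)"
    by (simp add: scalar_prod_M_mat u v mult.commute)
next
  fix v :: "real vec"
  assume v: "v \<in> carrier_vec N" "v \<noteq> 0\<^sub>v N"
  then obtain k where "k < N" "v $ k \<noteq> 0"
    by (metis carrier_vecD eq_vecI index_zero_vec)
  then show "0 < v \<bullet> (M_mat *\<^sub>v v)"
    using scalar_prod_M_mat_self[OF v(1)] M_form_pos by metis
qed (rule carrier M_mat_carrier)+

lemma kappa_milu_bound:
  assumes "0 < N"
  shows "0 \<le> kappa (mat_inv M_mat * A_mat)" "kappa (mat_inv M_mat * A_mat) \<le> 1 / (1 - \<tau>)"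
proof -
  have "1 * (v \<bullet> (M_mat *\<^sub>v v)) \<le> v \<bullet> (A_mat *\<^sub>v v)"
    and "v \<bullet> (A_mat *\<^sub>v v) \<le> 1 / (1 - \<tau>) * (v \<bullet> (M_mat *\<^sub>v v))" if "v \<in> carrier_vec N" for v
    using M_form_le_A_form A_form_le_M_form[of "($) v"] less_one that
    by (simp_all add: scalar_prod_A_mat_self scalar_prod_M_mat_self field_simps)
  from kappa_bound[OF assms _ this]
  show "0 \<le> kappa (mat_inv M_mat * A_mat)" "kappa (mat_inv M_mat * A_mat) \<le> 1 / (1 - \<tau>)"
    by simp_all
qed

end

section \<open>The finite difference stencils\<close>

text \<open>The entry of \<open>h\<^sup>2 A\<close> that belongs to a given offset between two grid points.\<close>
definition stencil :: "fd_scheme \<Rightarrow> int \<times> int \<Rightarrow> real" where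
  "stencil S = (\<lambda>(p, q). - (c_coeff S p * v_coeff S q + v_coeff S p * c_coeff S q))"

lemma sum_unit_impulse:
  fixes f :: "int \<Rightarrow> real"
  assumes "\<And>r. m < \<bar>r\<bar> \<Longrightarrow> f r = 0"
  shows "(\<Sum>r = -m..m. f r * (if i + r = i' then y else 0)) = f (i' - i) * y"
proof -
  have "(\<Sum>r = -m..m. f r * (if i + r = i' then y else 0))
      = (\<Sum>r = -m..m. if r = i' - i then f r * y else 0)"
    by (intro sum.cong) auto
  then show ?thesis using assms[of "i' - i"] by auto
qed

lemma v_coeff_outside: "2 < \<bar>r\<bar> \<Longrightarrow> v_coeff S r = 0"
  by (auto simp: v_coeff_def)

lemma c_coeff_outside: "half_width S < \<bar>s\<bar> \<Longrightarrow> c_coeff S s = 0"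
  by (cases S) auto

lemma c_coeff_outside_2: "2 < \<bar>s\<bar> \<Longrightarrow> c_coeff S s = 0"
  by (cases S) auto

lemma fd_entry_eq_stencil: "fd_entry S h K K' = stencil S (K' - K) / h\<^sup>2"
proof -
  obtain i j i' j' where K: "K = (i, j)" "K' = (i', j')" by (metis surj_pair)
  let ?u = "\<lambda>P. if P = K' then 1 else 0 :: real"
  have "Dy S ?u (i + s, j) = (if i + s = i' then v_coeff S (j' - j) else 0)" for s
    using sum_unit_impulse[of 2 "v_coeff S" j j' 1, OF v_coeff_outside] by (auto simp: Dy_def K)
  moreover have "Dx S ?u (i, j + s) = (if j + s = j' then v_coeff S (i' - i) else 0)" for s
    using sum_unit_impulse[of 2 "v_coeff S" i i' 1, OF v_coeff_outside] by (auto simp: Dx_def K)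
  ultimately have "fd_entry S h K K'
      = - (1 / h\<^sup>2) * (c_coeff S (i' - i) * v_coeff S (j' - j))
        - (1 / h\<^sup>2) * (c_coeff S (j' - j) * v_coeff S (i' - i))"
    unfolding fd_entry_def fd_op_def
    by (simp only: K prod.case sum_unit_impulse[OF c_coeff_outside])
  then show ?thesis by (simp add: K stencil_def diff_divide_distrib mult.commute)
qed

lemma stencil_uminus: "stencil S (- P) = stencil S P"
proof -
  have "c_coeff S (- s) = c_coeff S s" "v_coeff S (- s) = v_coeff S s" for s
    by (cases S; simp add: v_coeff_def)+
  then show ?thesis by (cases P) (simp add: stencil_def)
qed

lemma stencil_outside: "P \<notin> {-2..2} \<times> {-2..2} \<Longrightarrow> stencil S P = 0"
  by (cases P) (auto simp: stencil_def v_coeff_outside c_coeff_outside_2 not_le)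

lemma stencil_centre_pos: "0 < stencil S 0"
  by (cases S) (simp_all add: stencil_def v_coeff_def zero_prod_def)

lemma stencil_nonpos: "P \<noteq> 0 \<Longrightarrow> stencil S P \<le> 0"
  by (cases S; cases P) (auto simp: stencil_def v_coeff_def zero_prod_def)

text \<open>The consistency condition \<open>\<Sum>s. c s = 0\<close>: the operator annihilates constants.\<close>
lemma sum_stencil: "(\<Sum>P\<in>{-2..2} \<times> {-2..2}. stencil S P) = 0"
proof -
  have range: "{-2..2} = {-2, -1, 0, 1, 2 :: int}" by auto
  have "(\<Sum>s\<in>{-2..2}. c_coeff S s) = 0"
    unfolding range by (cases S) auto
  then have "(\<Sum>p\<in>{-2..2}. \<Sum>q\<in>{-2..2}. c_coeff S p * v_coeff S q) = 0"
    "(\<Sum>p\<in>{-2..2}. \<Sum>q\<in>{-2..2}. v_coeff S p * c_coeff S q) = 0"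
    unfolding sum_product[symmetric] by simp_all
  then show ?thesis
    by (simp add: stencil_def sum.distrib sum_negf sum_subtractf flip: sum.cartesian_product)
qed

definition later_offsets :: "(int \<times> int) set" where
  "later_offsets = {P \<in> {-2..2} \<times> {-2..2}. lex_less 0 P}"

text \<open>By the point symmetry of the stencil the entries before and after the centre sum to the same
value, and both together cancel the entry of the centre.\<close>
lemma sum_later_offsets: "(\<Sum>P\<in>later_offsets. - stencil S P) = stencil S 0 / 2"
proof -
  have fin: "finite later_offsets" by (simp add: later_offsets_def)
  have "{-2..2} \<times> {-2..2} = insert 0 (later_offsets \<union> uminus ` later_offsets)"
  proof (intro equalityI subsetI)
    fix P :: "int \<times> int" assume P: "P \<in> {-2..2} \<times> {-2..2}"
    then have "P = 0 \<or> P \<in> later_offsets \<or> - P \<in> later_offsets"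
      by (auto simp: later_offsets_def lex_less_def zero_prod_def)
    then show "P \<in> insert 0 (later_offsets \<union> uminus ` later_offsets)"
      by (metis UnI1 UnI2 imageI insert_iff minus_minus)
  qed (auto simp: later_offsets_def zero_prod_def)
  moreover have "0 \<notin> later_offsets \<union> uminus ` later_offsets"
    by (auto simp: later_offsets_def lex_less_def zero_prod_def)
  moreover have "later_offsets \<inter> uminus ` later_offsets = {}"
    by (auto simp: later_offsets_def lex_less_def)
  ultimately have "(\<Sum>P\<in>{-2..2} \<times> {-2..2}. stencil S P)
      = stencil S 0 + ((\<Sum>P\<in>later_offsets. stencil S P) + (\<Sum>P\<in>uminus ` later_offsets. stencil S P))"
    using fin by (simp add: sum.union_disjoint)
  also have "(\<Sum>P\<in>uminus ` later_offsets. stencil S P) = (\<Sum>P\<in>later_offsets. stencil S P)"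
    by (subst sum.reindex) (auto simp: stencil_uminus)
  finally show ?thesis by (simp add: sum_stencil sum_negf)
qed

text \<open>Near the boundary a part of the stencil is cut off, which can only decrease the sum of
the absolute values.\<close>
lemma sum_stencil_later_le:
  assumes "finite J" "inj_on f J" "\<And>j. j \<in> J \<Longrightarrow> lex_less 0 (f j)"
  shows "(\<Sum>j\<in>J. - stencil S (f j)) \<le> stencil S 0 / 2"
proof -
  have "(\<Sum>j\<in>J. - stencil S (f j)) = (\<Sum>P\<in>f ` J. - stencil S P)"
    using assms by (simp add: sum.reindex)
  also have "\<dots> = (\<Sum>P\<in>f ` J \<inter> later_offsets. - stencil S P)"
    using assms stencil_outside by (intro sum.mono_neutral_right) (auto simp: later_offsets_def)
  also have "\<dots> \<le> (\<Sum>P\<in>later_offsets. - stencil S P)"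
    by (intro sum_mono2) (auto simp: later_offsets_def lex_less_def intro!: stencil_nonpos)
  finally show ?thesis by (simp add: sum_later_offsets)
qed

section \<open>Lexicographic numbering of the grid\<close>

lemma nth_point_lex_less:
  assumes "0 < ny"
  shows "lex_less (nth_point ny k) (nth_point ny l) \<longleftrightarrow> k < l"
proof -
  have mono: "lex_less (nth_point ny k) (nth_point ny l)" if "k < l" for k l
  proof (cases "k div ny = l div ny")
    case True
    then have "k mod ny < l mod ny" using that by (metis div_mult_mod_eq nat_add_left_cancel_less)
    with True show ?thesis by (simp add: lex_less_def nth_point_def)
  next
    case False
    then have "k div ny < l div ny" using that by (simp add: div_le_mono le_neq_implies_less)
    then show ?thesis by (simp add: lex_less_def nth_point_def)
  qed
  show ?thesis
    using mono[of k l] mono[of l k]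
    by (cases k l rule: linorder_cases) (auto simp: lex_less_def)
qed

lemma inj_nth_point: "0 < ny \<Longrightarrow> inj (nth_point ny)"
  by (rule injI) (metis nth_point_lex_less lex_less_def less_irrefl linorder_neqE_nat)

lemma nth_point_image:
  assumes "0 < ny"
  shows "nth_point ny ` {..<nx * ny} = grid nx ny"
proof (intro equalityI subsetI)
  fix P assume "P \<in> nth_point ny ` {..<nx * ny}"
  then obtain m where m: "m < nx * ny" "P = nth_point ny m" by auto
  have "m div ny < nx" "m mod ny < ny"
    using less_mult_imp_div_less[OF m(1)] assms by simp_all
  then show "P \<in> grid nx ny"
    unfolding m(2) nth_point_def grid_def by simp
next
  fix P assume "P \<in> grid nx ny"
  then have bounds: "1 \<le> fst P" "fst P \<le> int nx" "1 \<le> snd P" "snd P \<le> int ny"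
    by (auto simp: grid_def)
  define i j where "i = nat (fst P - 1)" and "j = nat (snd P - 1)"
  have P: "P = (int i + 1, int j + 1)" "i < nx" "j < ny"
    using bounds by (auto simp: i_def j_def prod_eq_iff)
  have "i * ny + j < Suc i * ny" using P by simp
  also have "\<dots> \<le> nx * ny" using P by (intro mult_le_mono1) simp
  finally have "i * ny + j < nx * ny" .
  moreover have "nth_point ny (i * ny + j) = P" using P by (simp add: nth_point_def)
  ultimately show "P \<in> nth_point ny ` {..<nx * ny}" by force
qed

lemma sum_preds:
  fixes a :: "point \<Rightarrow> point \<Rightarrow> real"
  assumes "0 < ny" "k < nx * ny"
  shows "(\<Sum>K\<in>preds nx ny a (nth_point ny k). a (nth_point ny k) K * f K)
    = (\<Sum>m<k. a (nth_point ny k) (nth_point ny m) * f (nth_point ny m))"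
proof -
  have "preds nx ny a (nth_point ny k)
      = {K \<in> nth_point ny ` {..<k}. a (nth_point ny k) K \<noteq> 0}"
    using assms nth_point_lex_less[OF assms(1)] inj_nth_point[OF assms(1)]
    by (auto simp: preds_def nbrs_def inj_eq simp flip: nth_point_image[OF assms(1)])
  then have "(\<Sum>K\<in>preds nx ny a (nth_point ny k). a (nth_point ny k) K * f K)
      = (\<Sum>K\<in>nth_point ny ` {..<k}. a (nth_point ny k) K * f K)"
    by (intro sum.mono_neutral_left) auto
  then show ?thesis
    using inj_nth_point[OF assms(1)] by (simp add: sum.reindex inj_on_subset)
qed

lemma sum_succs:
  fixes a :: "point \<Rightarrow> point \<Rightarrow> real"
  assumes "0 < ny" "k < nx * ny"
  shows "(\<Sum>K\<in>succs nx ny a (nth_point ny k). a (nth_point ny k) K * f K)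
    = (\<Sum>l\<in>{k<..<nx * ny}. a (nth_point ny k) (nth_point ny l) * f (nth_point ny l))"
proof -
  have "succs nx ny a (nth_point ny k)
      = {K \<in> nth_point ny ` {k<..<nx * ny}. a (nth_point ny k) K \<noteq> 0}"
    using assms nth_point_lex_less[OF assms(1)] inj_nth_point[OF assms(1)]
    by (auto simp: succs_def nbrs_def inj_eq simp flip: nth_point_image[OF assms(1)])
  then have "(\<Sum>K\<in>succs nx ny a (nth_point ny k). a (nth_point ny k) K * f K)
      = (\<Sum>K\<in>nth_point ny ` {k<..<nx * ny}. a (nth_point ny k) K * f K)"
    by (intro sum.mono_neutral_left) auto
  then show ?thesis
    using inj_nth_point[OF assms(1)] by (simp add: sum.reindex inj_on_subset)
qed

lemma milu_diag_recursion:
  assumes "0 < ny" "k < nx * ny"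
  shows "milu_diag nx ny a (nth_point ny k) = a (nth_point ny k) (nth_point ny k)
    - (\<Sum>m<k. \<Sum>l\<in>{m<..<nx * ny}. a (nth_point ny k) (nth_point ny m)
        * a (nth_point ny m) (nth_point ny l) / milu_diag nx ny a (nth_point ny m))"
proof -
  let ?g = "\<lambda>K1. \<Sum>K2\<in>succs nx ny a K1. a K1 K2 * (1 / milu_diag nx ny a K1)"
  have "milu_diag nx ny a (nth_point ny k) = a (nth_point ny k) (nth_point ny k)
      - (\<Sum>K1\<in>preds nx ny a (nth_point ny k). a (nth_point ny k) K1 * ?g K1)"
    by (subst milu_diag.simps) (simp add: sum_distrib_left)
  also have "(\<Sum>K1\<in>preds nx ny a (nth_point ny k). a (nth_point ny k) K1 * ?g K1)
      = (\<Sum>m<k. a (nth_point ny k) (nth_point ny m) * ?g (nth_point ny m))"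
    using sum_preds[OF assms] .
  also have "\<dots> = (\<Sum>m<k. \<Sum>l\<in>{m<..<nx * ny}. a (nth_point ny k) (nth_point ny m)
        * a (nth_point ny m) (nth_point ny l) / milu_diag nx ny a (nth_point ny m))"
  proof (intro sum.cong refl)
    fix m assume "m \<in> {..<k}"
    then have "m < nx * ny" using assms(2) by simp
    from sum_succs[OF assms(1) this, of a "\<lambda>_. 1 / milu_diag nx ny a (nth_point ny m)"]
    show "a (nth_point ny k) (nth_point ny m) * ?g (nth_point ny m)
      = (\<Sum>l\<in>{m<..<nx * ny}. a (nth_point ny k) (nth_point ny m)
        * a (nth_point ny m) (nth_point ny l) / milu_diag nx ny a (nth_point ny m))"
      by (simp add: sum_distrib_left mult.assoc)
  qed
  finally show ?thesis .
qed

section \<open>The preconditioned finite difference matrix\<close>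

text \<open>The level \<open>3 i + j\<close> of a grid point \<open>(i, j)\<close>: the weight \<open>3\<close> is the least one for
which an increase of \<open>i\<close> by \<open>1\<close> outweighs a decrease of \<open>j\<close> by \<open>2\<close>, the range of the stencil.\<close>
lemma stencil_level_step:
  assumes "lex_less 0 P" "stencil S P \<noteq> 0"
  shows "1 \<le> 3 * fst P + snd P"
proof -
  have "P \<in> {-2..2} \<times> {-2..2}" using assms(2) stencil_outside by blast
  with assms(1) show ?thesis by (auto simp: lex_less_def)
qed

text \<open>The largest level on the grid is \<open>3 n\<^sub>x + n\<^sub>y\<close>; this is where the value of \<open>\<tau>\<close> comes from.\<close>
lemma milu_factorization_fd:
  fixes S :: fd_scheme
  assumes "0 < h" "0 < nx" "0 < ny"
  defines "\<tau> \<equiv> (3 * real nx + real ny) / (3 * real nx + real ny + 1)"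
  shows "milu_factorization (nx * ny)
    (\<lambda>k l. fd_entry S h (nth_point ny k) (nth_point ny l))
    (\<lambda>k. milu_diag nx ny (fd_entry S h) (nth_point ny k)) \<tau>"
    (is "milu_factorization ?N ?a ?e \<tau>")
proof -
  let ?P = "nth_point ny"
  define \<sigma> where "\<sigma> = stencil S 0 / 2 / h\<^sup>2"
  define level where "level k = 3 * real_of_int (fst (?P k)) + real_of_int (snd (?P k))" for k
  have "0 < \<sigma>" using stencil_centre_pos[of S] \<open>0 < h\<close> by (simp add: \<sigma>_def)
  have a: "?a k l = stencil S (?P l - ?P k) / h\<^sup>2" for k l
    by (rule fd_entry_eq_stencil)
  have a_sym: "?a k l = ?a l k" for k l
    unfolding a using stencil_uminus[of S "?P l - ?P k"] by simp
  have inj: "inj ?P" by (rule inj_nth_point[OF \<open>0 < ny\<close>])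
  have later: "lex_less 0 (?P l - ?P k)" if "k < l" for k l
    using that nth_point_lex_less[OF \<open>0 < ny\<close>, of k l] by (auto simp: lex_less_def)
  have a_nonpos: "?a k l \<le> 0" if "k \<noteq> l" for k l
    unfolding a using that injD[OF inj, of l k]
    by (intro divide_nonpos_nonneg stencil_nonpos) auto
  interpret milu_recursion ?N ?a ?e
  proof
    show "?a k l = ?a l k" for k l by (rule a_sym)
    show "?a k l \<le> 0" if "k \<noteq> l" for k l using that by (rule a_nonpos)
    show "?e k = ?a k k - (\<Sum>m<k. \<Sum>l\<in>{m<..<?N}. ?a k m * ?a m l / ?e m)" if "k < ?N" for k
      by (rule milu_diag_recursion[OF \<open>0 < ny\<close> that])
  qed
  have a_diag: "?a k k = 2 * \<sigma>" for k
    by (simp add: a \<sigma>_def)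
  have half: "(\<Sum>j\<in>J. - stencil S (f j)) / h\<^sup>2 \<le> \<sigma>"
    if "finite J" "inj_on f J" "\<And>j. j \<in> J \<Longrightarrow> lex_less 0 (f j)" for f and J :: "nat set"
    unfolding \<sigma>_def using sum_stencil_later_le[OF that] by (intro divide_right_mono) auto
  have upper: "upper_sum k \<le> \<sigma>" for k
  proof -
    have "upper_sum k = (\<Sum>l\<in>{k<..<?N}. - stencil S (?P l - ?P k)) / h\<^sup>2"
      unfolding upper_sum_def by (simp add: a sum_divide_distrib)
    also have "\<dots> \<le> \<sigma>"
      by (intro half) (auto intro!: later inj_onI injD[OF inj])
    finally show ?thesis .
  qed
  have lower: "(\<Sum>m<k. - ?a k m) \<le> \<sigma>" for k
  proof -
    have "(\<Sum>m<k. - ?a k m) = (\<Sum>m<k. - stencil S (?P k - ?P m)) / h\<^sup>2"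
      unfolding sum_divide_distrib by (intro sum.cong refl) (subst a_sym, simp add: a)
    also have "\<dots> \<le> \<sigma>"
      by (intro half) (auto intro!: later inj_onI injD[OF inj])
    finally show ?thesis .
  qed
  have level_ge: "1 \<le> level k" for k
    by (simp add: level_def nth_point_def)
  have level_step: "level m + 1 \<le> level k" if "m < k" "?a k m \<noteq> 0" for k m
  proof -
    have "?a m k \<noteq> 0" using that(2) a_sym by metis
    then have "stencil S (?P k - ?P m) \<noteq> 0" by (simp add: a)
    then have "1 \<le> 3 * fst (?P k - ?P m) + snd (?P k - ?P m)"
      using stencil_level_step later[OF that(1)] by blast
    then have "real_of_int 1 \<le> real_of_int (3 * fst (?P k - ?P m) + snd (?P k - ?P m))"
      by (rule of_int_le_iff[THEN iffD2])
    then show ?thesis by (simp add: level_def)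
  qed
  have pivot: "0 < ?e k \<and> upper_sum k \<le> level k / (level k + 1) * ?e k" if "k < ?N" for k
    using \<open>0 < \<sigma>\<close> a_diag lower upper level_ge level_step that by (rule pivot_bound)
  show ?thesis
  proof
    fix k assume k: "k < ?N"
    \<comment> \<open>The truncated stencil is diagonally dominant.\<close>
    have "(\<Sum>l<?N. ?a k l) = ?a k k - (\<Sum>m<k. - ?a k m) - upper_sum k"
      unfolding sum_row_split[OF k] upper_sum_def by (simp add: sum_negf)
    then show "0 \<le> (\<Sum>l<?N. ?a k l)"
      using a_diag[of k] lower[of k] upper[of k] by linarith
    show "0 < ?e k" using pivot[OF k] by simp
    have "?P k \<in> grid nx ny" using nth_point_image[OF \<open>0 < ny\<close>, of nx] k by blast
    then have "real_of_int (fst (?P k)) \<le> real nx" "real_of_int (snd (?P k)) \<le> real ny"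
      by (auto simp: grid_def)
    then have "level k \<le> 3 * real nx + real ny" by (simp add: level_def)
    then have "level k / (level k + 1) \<le> \<tau>"
      unfolding \<tau>_def using level_ge[of k] by (simp add: field_simps)
    then have "level k / (level k + 1) * ?e k \<le> \<tau> * ?e k"
      using pivot[OF k] by (intro mult_right_mono) auto
    then show "upper_sum k \<le> \<tau> * ?e k" using pivot[OF k] by linarith
  next
    show "\<tau> < 1" by (simp add: \<tau>_def field_simps)
  qed
qed

lemma kappa_fd_bound:
  assumes "0 < h" "0 < nx" "0 < ny"
  shows "0 \<le> kappa (mat_inv (milu_mat S h nx ny) * fd_mat S h nx ny)"
    and "kappa (mat_inv (milu_mat S h nx ny) * fd_mat S h nx ny) \<le> 3 * real nx + real ny + 1"
proof -
  let ?\<tau> = "(3 * real nx + real ny) / (3 * real nx + real ny + 1)"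
  let ?a = "fd_entry S h" and ?P = "nth_point ny"
  interpret milu_factorization "nx * ny" "\<lambda>k l. ?a (?P k) (?P l)"
    "\<lambda>k. milu_diag nx ny ?a (?P k)" ?\<tau>
    by (rule milu_factorization_fd[OF assms])
  have A: "fd_mat S h nx ny = A_mat"
    by (simp add: fd_mat_def grid_mat_def A_mat_def)
  have E: "grid_mat nx ny (\<lambda>K K'. if K = K' then milu_diag nx ny ?a K else 0) = E_mat"
    using inj_nth_point[OF assms(3)]
    by (auto simp: grid_mat_def E_mat_def inj_eq intro!: eq_matI)
  have pred: "?P l \<in> preds nx ny ?a (?P k) \<longleftrightarrow> l < k \<and> ?a (?P k) (?P l) \<noteq> 0"
    if "k < nx * ny" "l < nx * ny" for k l
    using that inj_nth_point[OF assms(3)] nth_point_lex_less[OF assms(3)]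
    by (auto simp: preds_def nbrs_def inj_eq simp flip: nth_point_image[OF assms(3)])
  have "grid_mat nx ny (\<lambda>K K'. if K' \<in> preds nx ny ?a K then ?a K K' else 0) + E_mat = F_mat"
    by (rule eq_matI) (auto simp: grid_mat_def E_mat_def F_mat_def pred)
  then have M: "milu_mat S h nx ny = M_mat"
    by (simp add: milu_mat_def milu_def Let_def E M_mat_def)
  have "1 / (1 - ?\<tau>) = 3 * real nx + real ny + 1"
    by (simp add: field_simps)
  then show "0 \<le> kappa (mat_inv (milu_mat S h nx ny) * fd_mat S h nx ny)"
    "kappa (mat_inv (milu_mat S h nx ny) * fd_mat S h nx ny) \<le> 3 * real nx + real ny + 1"
    unfolding A M using kappa_milu_bound assms by simp_all
qed

text \<open>The bound is uniform: on every admissible grid \<open>3 n\<^sub>x + n\<^sub>y + 1 \<le> (3 l\<^sub>x + l\<^sub>y) / h\<close>.\<close>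
theorem corollary3p4:
  fixes S :: fd_scheme and lx ly :: real
  assumes "lx > 0" and "ly > 0"
  shows "(\<lambda>(h, nx, ny). kappa (mat_inv (milu_mat S h nx ny) * fd_mat S h nx ny))
           \<in> O[mesh_refinement lx ly](\<lambda>(h, nx, ny). 1 / h)"
proof (rule bigoI)
  let ?Q = "\<lambda>(h, nx, ny). norm (kappa (mat_inv (milu_mat S h nx ny) * fd_mat S h nx ny))
    \<le> (3 * lx + ly) * norm (1 / h)"
  have "?Q (h, nx, ny)"
    if "1 \<le> nx" "1 \<le> ny" and lx: "(real nx + 1) * h = lx" and ly: "(real ny + 1) * h = ly"
    for h nx ny
  proof -
    have "0 < h" using lx \<open>lx > 0\<close> by (simp add: zero_less_mult_iff flip: lx)
    then have "3 * real nx + real ny + 1 \<le> (3 * lx + ly) / h"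
      by (simp add: field_simps flip: lx ly)
    then show ?thesis
      using kappa_fd_bound[of h nx ny S] \<open>0 < h\<close> that by simp
  qed
  then have "\<forall>\<^sub>F x in mesh_refinement lx ly. ?Q x"
    unfolding mesh_refinement_def eventually_inf_principal by (intro always_eventually) auto
  then show "\<forall>\<^sub>F x in mesh_refinement lx ly.
      norm (case x of (h, nx, ny) \<Rightarrow> kappa (mat_inv (milu_mat S h nx ny) * fd_mat S h nx ny))
      \<le> (3 * lx + ly) * norm (case x of (h, nx, ny) \<Rightarrow> 1 / h)"
    by (rule eventually_mono) auto
qed

end
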